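(* Let $X$ be a Banach space and let $D\subset X^*$ be an $r$-norming subspace ($r\ge 1$). The following properties are equivalent: (i) $X$ has an $r$-projectional skeleton $\mathfrak s$ with $D=D(\mathfrak s)$. (ii) $X$ has a simple $r$-projectional skeleton $\mathfrak s$ with $D=D(\mathfrak s)$. Likewise, the following properties are equivalent: (i') $X$ has a commutative $r$-projectional skeleton $\mathfrak s$ with $D=D(\mathfrak s)$. (ii') $X$ has a simple commutative $r$-projectional skeleton $\mathfrak s$ with $D=D(\mathfrak s)$.
   Context: Banach spaces are over the real numbers; $X^*$ is the dual of $X$ and $B_{X^*}$ its unit ball. A set $D\subset X^*$ is $r$-norming if for every $x\in X$, $\|x\|\le r\cdot\sup\{|x^*(x)|:\ x^*\in D\cap B_{X^*}\}$. A projectional skeleton in a Banach space $X$ is a family of bounded projections $\{P_s\}_{s\in\Gamma}$ on $X$ indexed by an up-directed partially ordered set $\Gamma$ such that: (1) each $P_sX$ is separable; (2) $X=\bigcup_{s\in\Gamma}P_sX$; (3) $s\le t\Rightarrow P_s=P_s\circ P_t=P_t\circ P_s$; (4) given $s_1<s_2<\cdots$ in $\Gamma$, $t=\sup_n s_n$ exists and $P_tX=\overline{\bigcup_{n}P_{s_n}X}$. It is an $r$-projectional skeleton if moreover $\|P_s\|\le r$ for every $s\in\Gamma$. It is commutative if $P_s\circ P_t=P_t\circ P_s$ for all $s,t\in\Gamma$. A family $\mathcal F$ of separable subspaces of $X$ is called rich if each separable subspace of $X$ is contained in an element of $\mathcal F$, and for every increasing sequence $(F_i)_{i\ge1}$ in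 $\mathcal F$, $\overline{\bigcup_{i=1}^\infty F_i}$ belongs to $\mathcal F$. A simple projectional skeleton in $X$ is a family of bounded projections $\{P_F\}_{F\in\mathcal F}$ on $X$ indexed by a rich family $\mathcal F$ of separable subspaces of $X$ such that: (1) $P_F(X)=F$ for every $F\in\mathcal F$; (2) if $E\subset F$ in $\mathcal F$, then $P_E=P_E\circ P_F=P_F\circ P_E$. It is a simple $r$-projectional skeleton if moreover $\|P_F\|\le r$ for every $F\in\mathcal F$. It is commutative if $P_E\circ P_F=P_F\circ P_E$ for all $E,F\in\mathcal F$. For a (simple) projectional skeleton $\mathfrak s=\{P_s\}_{s\in\Gamma}$ put $D(\mathfrak s)=\bigcup_{s\in\Gamma}P_s^*[X^*]$, where $P_s^*$ is the adjoint of $P_s$. *)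

theory Defs
  imports "HOL-Analysis.Analysis"
begin

abbreviation separable_set :: "'a::topological_space set \<Rightarrow> bool" where
  "separable_set S \<equiv> separable_space (top_of_set S)"

(* The dual of 'a is the type 'a \<Rightarrow>\<^sub>L real, normed by the operator norm.
   The supremum is one of a bounded set of reals; that set is nonempty as soon as 0 \<in> D. *)
definition norming :: "real \<Rightarrow> ('a::real_normed_vector \<Rightarrow>\<^sub>L real) set \<Rightarrow> bool" where
  "norming r D \<longleftrightarrow>
     (\<forall>x. norm x \<le> r * (SUP f \<in> D \<inter> cball 0 1. \<bar>blinfun_apply f x\<bar>))"

definition bounded_projection :: "('a::real_normed_vector \<Rightarrow>\<^sub>L 'a) \<Rightarrow> bool" where
  "bounded_projection P \<longleftrightarrow> P o\<^sub>L P = P"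

definition adjoint_blinfun ::
  "('a::real_normed_vector \<Rightarrow>\<^sub>L 'b::real_normed_vector) \<Rightarrow> ('b \<Rightarrow>\<^sub>L real) \<Rightarrow> ('a \<Rightarrow>\<^sub>L real)" where
  "adjoint_blinfun T f = f o\<^sub>L T"

definition up_directed_on :: "'i set \<Rightarrow> 'i rel \<Rightarrow> bool" where
  "up_directed_on I R \<longleftrightarrow> (\<forall>s\<in>I. \<forall>t\<in>I. \<exists>u\<in>I. (s, u) \<in> R \<and> (t, u) \<in> R)"

definition is_supremum_on :: "'i set \<Rightarrow> 'i rel \<Rightarrow> 'i set \<Rightarrow> 'i \<Rightarrow> bool" where
  "is_supremum_on I R A t \<longleftrightarrow>
     t \<in> I \<and> (\<forall>s\<in>A. (s, t) \<in> R) \<and> (\<forall>u\<in>I. (\<forall>s\<in>A. (s, u) \<in> R) \<longrightarrow> (t, u) \<in> R)"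

(* The index poset has carrier I and order relation R, where (s, t) \<in> R stands for s \<le> t;
   only the values of P on I matter. *)
definition projectional_skeleton ::
  "'i set \<Rightarrow> 'i rel \<Rightarrow> ('i \<Rightarrow> ('a::real_normed_vector \<Rightarrow>\<^sub>L 'a)) \<Rightarrow> bool" where
  "projectional_skeleton I R P \<longleftrightarrow>
     partial_order_on I R \<and> up_directed_on I R \<and>
     (\<forall>s\<in>I. bounded_projection (P s)) \<and>
     (\<forall>s\<in>I. separable_set (range (blinfun_apply (P s)))) \<and>
     (\<Union>s\<in>I. range (blinfun_apply (P s))) = UNIV \<and>
     (\<forall>s\<in>I. \<forall>t\<in>I. (s, t) \<in> R \<longrightarrow> P s = P s o\<^sub>L P t \<and> P s = P t o\<^sub>L P s) \<and>
     (\<forall>\<sigma>::nat \<Rightarrow> 'i.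
        (\<forall>n. \<sigma> n \<in> I) \<and> (\<forall>n. (\<sigma> n, \<sigma> (Suc n)) \<in> R \<and> \<sigma> n \<noteq> \<sigma> (Suc n)) \<longrightarrow>
        (\<exists>t. is_supremum_on I R (range \<sigma>) t \<and>
             range (blinfun_apply (P t)) = closure (\<Union>n. range (blinfun_apply (P (\<sigma> n))))))"

definition rich_family :: "'a::real_normed_vector set set \<Rightarrow> bool" where
  "rich_family \<F> \<longleftrightarrow>
     (\<forall>F\<in>\<F>. subspace F \<and> separable_set F) \<and>
     (\<forall>S. subspace S \<and> separable_set S \<longrightarrow> (\<exists>F\<in>\<F>. S \<subseteq> F)) \<and>
     (\<forall>E::nat \<Rightarrow> 'a set. (\<forall>n. E n \<in> \<F>) \<and> (\<forall>n. E n \<subseteq> E (Suc n)) \<longrightarrow> closure (\<Union>n. E n) \<in> \<F>)"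

definition simple_projectional_skeleton ::
  "'a set set \<Rightarrow> ('a set \<Rightarrow> ('a::real_normed_vector \<Rightarrow>\<^sub>L 'a)) \<Rightarrow> bool" where
  "simple_projectional_skeleton \<F> P \<longleftrightarrow>
     rich_family \<F> \<and>
     (\<forall>F\<in>\<F>. bounded_projection (P F)) \<and>
     (\<forall>F\<in>\<F>. range (blinfun_apply (P F)) = F) \<and>
     (\<forall>E\<in>\<F>. \<forall>F\<in>\<F>. E \<subseteq> F \<longrightarrow> P E = P E o\<^sub>L P F \<and> P E = P F o\<^sub>L P E)"

definition norms_bounded_by ::
  "real \<Rightarrow> 'i set \<Rightarrow> ('i \<Rightarrow> ('a::real_normed_vector \<Rightarrow>\<^sub>L 'a)) \<Rightarrow> bool" where
  "norms_bounded_by r I P \<longleftrightarrow> (\<forall>s\<in>I. norm (P s) \<le> r)"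

definition commutative_family ::
  "'i set \<Rightarrow> ('i \<Rightarrow> ('a::real_normed_vector \<Rightarrow>\<^sub>L 'a)) \<Rightarrow> bool" where
  "commutative_family I P \<longleftrightarrow> (\<forall>s\<in>I. \<forall>t\<in>I. P s o\<^sub>L P t = P t o\<^sub>L P s)"

definition induced_subspace ::
  "'i set \<Rightarrow> ('i \<Rightarrow> ('a::real_normed_vector \<Rightarrow>\<^sub>L 'a)) \<Rightarrow> ('a \<Rightarrow>\<^sub>L real) set" where
  "induced_subspace I P = (\<Union>s\<in>I. range (adjoint_blinfun (P s)))"

(* HOL cannot quantify existentially over types, so the type 'i in which the index poset
   is carved out is a parameter of the two non-simple existence statements. *)
definition has_skeleton ::
  "'i itself \<Rightarrow> real \<Rightarrow> ('a::real_normed_vector \<Rightarrow>\<^sub>L real) set \<Rightarrow> bool" where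
  "has_skeleton _ r D \<longleftrightarrow>
     (\<exists>(I::'i set) R P. projectional_skeleton I R P \<and> norms_bounded_by r I P \<and>
        D = induced_subspace I P)"

definition has_commutative_skeleton ::
  "'i itself \<Rightarrow> real \<Rightarrow> ('a::real_normed_vector \<Rightarrow>\<^sub>L real) set \<Rightarrow> bool" where
  "has_commutative_skeleton _ r D \<longleftrightarrow>
     (\<exists>(I::'i set) R P. projectional_skeleton I R P \<and> norms_bounded_by r I P \<and>
        commutative_family I P \<and> D = induced_subspace I P)"

definition has_simple_skeleton :: "real \<Rightarrow> ('a::real_normed_vector \<Rightarrow>\<^sub>L real) set \<Rightarrow> bool" where
  "has_simple_skeleton r D \<longleftrightarrow>
     (\<exists>\<F> P. simple_projectional_skeleton \<F> P \<and> norms_bounded_by r \<F> P \<and>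
        D = induced_subspace \<F> P)"

definition has_simple_commutative_skeleton ::
  "real \<Rightarrow> ('a::real_normed_vector \<Rightarrow>\<^sub>L real) set \<Rightarrow> bool" where
  "has_simple_commutative_skeleton r D \<longleftrightarrow>
     (\<exists>\<F> P. simple_projectional_skeleton \<F> P \<and> norms_bounded_by r \<F> P \<and>
        commutative_family \<F> P \<and> D = induced_subspace \<F> P)"

(* "has_skeleton for some index type" is equivalent to has_simple_skeleton once
     has_skeleton TYPE('i) implies has_simple_skeleton for an arbitrary type 'i, and
     has_simple_skeleton implies has_skeleton TYPE('a set). *)

end

theory Submission
  imports Defs
begin

text \<open>
  A simple skeleton is a skeleton as soon as its rich family is ordered by inclusion: increasing
  unions give the suprema, because the members of the family are closed, being ranges of
  projections. This is \<open>skeleton_of_simple_skeleton\<close>.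

  The converse needs a choice of indices. In a skeleton \<open>{P\<^sub>s}\<close> two indices may have the same range
  but different projections, so a projection \<open>P\<^sub>E\<close> with range \<open>E\<close> must be selected, and the
  selection has to respect inclusion. The plan is to read off from \<open>E\<close> a countable set \<open>A(E)\<close> of
  points, to choose once and for all an index \<open>c(x)\<close> with \<open>x\<close> in the range of \<open>P\<^bsub>c(x)\<^esub>\<close> for every
  point \<open>x\<close> and an upper bound for every pair of indices, and to let \<open>\<tau>(E)\<close> be the supremum of the
  countable directed set \<open>G(E)\<close> that these choices generate from \<open>A(E)\<close>. If \<open>A\<close> is monotone, so
  is \<open>\<tau>\<close>, and the family \<open>\<F>\<close> of the separable subspaces \<open>E\<close> that are the range of
  \<open>P\<^bsub>\<tau>(E)\<^esub>\<close> carries compatible projections. For \<open>\<F>\<close> to be rich, \<open>A(E)\<close> has to be dense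
  enough for \<open>E\<close> to lie in the range of \<open>P\<^bsub>\<tau>(E)\<^esub>\<close>, and \<open>A\<close> must commute with closures of
  increasing unions.

  Countable dense subsets of the spaces \<open>E\<close>, chosen one by one, need not grow with \<open>E\<close>, and
  intersecting with a fixed set does not commute with closures. Recording the open sets that \<open>E\<close>
  meets is monotone and insensitive to closures.
  Since metric spaces have \<open>\<sigma>\<close>-disjoint open covers of arbitrarily small mesh
  (the heart of the theorem that they are paracompact), a separable set meets only countably many
  members of such covers, and \<open>A(E)\<close> is the set of centres of the members that \<open>E\<close> meets
  (\<open>countable_trace\<close>).

  Finally, no functional of the induced subspace is lost. Given an index \<open>s\<close>, members of \<open>\<F>\<close> and
  indices above \<open>s\<close> are interleaved so that in the limit an index \<open>u\<close> above \<open>s\<close> and a member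
  \<open>F\<close> of \<open>\<F>\<close> have the same range while \<open>\<tau>(F) \<le> u\<close>. Comparable projections with the same range
  coincide, so \<open>P\<^sub>s\<close> factors through \<open>P\<^bsub>\<tau>(F)\<^esub>\<close>. All projections of the simple skeleton come from
  the given one, so norm bounds and commutativity are inherited.
\<close>

section \<open>Countable traces of separable sets\<close>

text \<open>
  This is the first step of Stone's theorem on paracompactness. Well-order the points and assign
  each \<open>x\<close> to the first ball of radius \<open>e\<close> that contains it. Among the points that lie
  \<open>3/(n+1)\<close>-deep in the ball assigned to them, those assigned to different balls are at least
  \<open>3/(n+1)\<close> apart, so their neighbourhoods of radius \<open>1/(n+1)\<close> are disjoint.
\<close>

lemma sigma_disjoint_open_cover:
  fixes e :: real
  assumes "e > 0"
  obtains U :: "nat \<Rightarrow> 'a::metric_space \<Rightarrow> 'a set"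
  where "\<And>n a. open (U n a)" "\<And>n a. U n a \<subseteq> ball a e"
    "\<And>n. disjoint_family (U n)" "\<And>x. \<exists>n a. x \<in> U n a"
proof -
  obtain r :: "'a rel" where r: "well_order_on UNIV r"
    using well_order_on[of "UNIV :: 'a set"] by blast
  then have wf: "wf (r - Id)" and tot: "total r"
    by (auto simp: well_order_on_def linear_order_on_def)
  define core where "core n a =
      {x. x \<in> ball a e \<and> (\<forall>b. (b, a) \<in> r - Id \<longrightarrow> x \<notin> ball b e) \<and>
          ball x (3 / real (Suc n)) \<subseteq> ball a e}" for n :: nat and a
  define U where "U n a = (\<Union>x\<in>core n a. ball x (1 / real (Suc n)))" for n a
  have sep: "U n a \<inter> U n b = {}" if ab: "(a, b) \<in> r - Id" for n a b
  proof (rule equals0I)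
    fix z assume "z \<in> U n a \<inter> U n b"
    then obtain x y where x: "x \<in> core n a" "dist x z < 1 / real (Suc n)"
      and y: "y \<in> core n b" "dist y z < 1 / real (Suc n)"
      by (auto simp: U_def)
    \<comment> \<open>the earlier ball, around \<open>a\<close>, contains the ball around \<open>x\<close> but not \<open>y\<close>\<close>
    have "y \<notin> ball x (3 / real (Suc n))"
      using x(1) y(1) ab unfolding core_def by blast
    moreover have "dist x y < 1 / real (Suc n) + 1 / real (Suc n)"
      using x(2) y(2) dist_triangle2[of x y z] by linarith
    moreover have "1 / real (Suc n) + 1 / real (Suc n) \<le> 3 / real (Suc n)"
      by (simp add: field_simps)
    ultimately show False by simp
  qed
  show thesis
  proof (rule that[of U])
    show "open (U n a)" for n a by (simp add: U_def open_UN)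
    show "U n a \<subseteq> ball a e" for n a
    proof
      fix z assume "z \<in> U n a"
      then obtain x where x: "x \<in> core n a" "dist x z < 1 / real (Suc n)"
        by (auto simp: U_def)
      have "1 / real (Suc n) \<le> 3 / real (Suc n)" by (simp add: field_simps)
      with x have "z \<in> ball x (3 / real (Suc n))" by simp
      with x(1) show "z \<in> ball a e" unfolding core_def by blast
    qed
    show "disjoint_family (U n)" for n
      unfolding disjoint_family_on_def
      using sep tot by (metis DiffI Int_commute UNIV_I pair_in_Id_conv total_on_def)
    show "\<exists>n a. x \<in> U n a" for x
    proof -
      have "x \<in> {a. x \<in> ball a e}" using assms by simp
      then obtain a where a: "x \<in> ball a e" "\<And>b. (b, a) \<in> r - Id \<Longrightarrow> x \<notin> ball b e"
        by (rule wfE_min[OF wf]) auto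
      obtain d where d: "d > 0" "ball x d \<subseteq> ball a e"
        using a(1) open_ball open_contains_ball by blast
      obtain n where n: "inverse (real (Suc n)) < d / 3"
        using reals_Archimedean[of "d / 3"] d(1) by auto
      then have "3 / real (Suc n) \<le> d" by (simp add: field_simps)
      then have "ball x (3 / real (Suc n)) \<subseteq> ball a e"
        using d(2) subset_ball by blast
      with a have "x \<in> core n a" by (simp add: core_def)
      then have "x \<in> U n a" unfolding U_def by (rule UN_I) simp
      then show ?thesis by blast
    qed
  qed
qed

lemma separable_set_iff:
  "separable_set S \<longleftrightarrow> (\<exists>C. countable C \<and> C \<subseteq> S \<and> S \<subseteq> closure C)"
proof -
  have "top_of_set S closure_of C = S \<longleftrightarrow> S \<subseteq> closure C" if "C \<subseteq> S" for C
    using that by (auto simp: closure_of_subtopology Int_absorb1)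
  then show ?thesis unfolding separable_space_def by auto
qed

lemma separable_setE:
  assumes "separable_set S"
  obtains C where "countable C" "C \<subseteq> S" "S \<subseteq> closure C"
  using assms unfolding separable_set_iff by blast

lemma separable_setI:
  assumes "countable C" "C \<subseteq> S" "S \<subseteq> closure C"
  shows "separable_set S"
  using assms unfolding separable_set_iff by blast

text \<open>
  A canonical countable set that approximates \<open>E\<close>. Its points need not lie in \<open>E\<close>: they are the
  centres of the members of fine covers that meet \<open>E\<close>. Membership is thus decided by open sets,
  which explains the compatibility with closures; disjointness lets every point of a countable
  dense subset of \<open>E\<close> account for only one member of each of countably many layers.
\<close>

lemma countable_trace:
  obtains A :: "'a::metric_space set \<Rightarrow> 'a set"
  where "\<And>E F. E \<subseteq> F \<Longrightarrow> A E \<subseteq> A F"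
    "\<And>E. separable_set E \<Longrightarrow> countable (A E)"
    "\<And>E. E \<subseteq> closure (A E)"
    "\<And>\<E>. A (closure (\<Union>\<E>)) = (\<Union>E\<in>\<E>. A E)"
proof -
  have "\<exists>U :: nat \<Rightarrow> 'a \<Rightarrow> 'a set. (\<forall>n a. open (U n a)) \<and> (\<forall>n a. U n a \<subseteq> ball a (1 / real (Suc k))) \<and>
      (\<forall>n. disjoint_family (U n)) \<and> (\<forall>x. \<exists>n a. x \<in> U n a)" for k
    by (rule sigma_disjoint_open_cover[of "1 / real (Suc k)"]) (simp, blast)
  then obtain U :: "nat \<Rightarrow> nat \<Rightarrow> 'a \<Rightarrow> 'a set" where
    U: "\<And>k n a. open (U k n a)" "\<And>k n a. U k n a \<subseteq> ball a (1 / real (Suc k))"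
      "\<And>k n. disjoint_family (U k n)" "\<And>k x. \<exists>n a. x \<in> U k n a"
    by metis
  define A where "A E = {a. \<exists>k n. U k n a \<inter> E \<noteq> {}}" for E
  show thesis
  proof (rule that[of A])
    show "A E \<subseteq> A F" if "E \<subseteq> F" for E F using that unfolding A_def by blast
    show "countable (A E)" if "separable_set E" for E
    proof -
      obtain C where C: "countable C" "C \<subseteq> E" "E \<subseteq> closure C"
        using \<open>separable_set E\<close> by (rule separable_setE)
      have meet: "U k n a \<inter> C \<noteq> {}" if "U k n a \<inter> E \<noteq> {}" for k n a
        using that C(3) U(1) open_Int_closure_eq_empty[of "U k n a" C] by blast
      have "A E \<subseteq> (\<Union>k. \<Union>n. \<Union>x\<in>C. {a. x \<in> U k n a})"
      proof
        fix a assume "a \<in> A E"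
        then obtain k n where "U k n a \<inter> C \<noteq> {}" unfolding A_def using meet by fast
        then show "a \<in> (\<Union>k. \<Union>n. \<Union>x\<in>C. {a. x \<in> U k n a})" by blast
      qed
      moreover have "countable {a. x \<in> U k n a}" for k n x
      proof -
        have "a = b" if "x \<in> U k n a" "x \<in> U k n b" for a b
          using U(3)[of k n] that unfolding disjoint_family_on_def by blast
        then have "{a. x \<in> U k n a} \<subseteq> {SOME a. x \<in> U k n a}"
          by (auto intro: someI2)
        then show ?thesis by (rule countable_subset) simp
      qed
      ultimately show ?thesis
        using C(1) by (meson countable_UN countable_subset countableI_type)
    qed
    show "E \<subseteq> closure (A E)" for E
    proof
      fix x assume x: "x \<in> E"
      show "x \<in> closure (A E)"
        unfolding closure_approachable
      proof (intro allI impI)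
        fix e :: real assume "e > 0"
        then obtain k where k: "inverse (real (Suc k)) < e"
          using reals_Archimedean by blast
        obtain n a where a: "x \<in> U k n a" using U(4) by blast
        then have "a \<in> A E" using x unfolding A_def by blast
        moreover have "dist a x < e"
          using U(2)[of k n a] a k by (auto simp: inverse_eq_divide)
        ultimately show "\<exists>y\<in>A E. dist y x < e" by blast
      qed
    qed
    show "A (closure (\<Union>\<E>)) = (\<Union>E\<in>\<E>. A E)" for \<E>
      unfolding A_def open_Int_closure_eq_empty[OF U(1)] by auto
  qed
qed

section \<open>Closing a countable set under joins\<close>

text \<open>
  Suprema are available only for increasing sequences, so a countable set of indices has to be made
  directed first. Closing it under a fixed choice \<open>j\<close> of upper bounds is finitary, hence monotone
  and compatible with increasing unions.
\<close>

inductive_set join_closure :: "('i \<Rightarrow> 'i \<Rightarrow> 'i) \<Rightarrow> 'i set \<Rightarrow> 'i set"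
  for j S where
    base: "s \<in> S \<Longrightarrow> s \<in> join_closure j S"
  | join: "s \<in> join_closure j S \<Longrightarrow> t \<in> join_closure j S \<Longrightarrow> j s t \<in> join_closure j S"

lemma join_closure_mono:
  assumes "S \<subseteq> T"
  shows "join_closure j S \<subseteq> join_closure j T"
proof
  fix s assume "s \<in> join_closure j S"
  then show "s \<in> join_closure j T"
    by induction (use assms in \<open>auto intro: join_closure.intros\<close>)
qed

lemma countable_join_closure:
  assumes "countable S"
  shows "countable (join_closure j S)"
proof -
  define T where "T n = ((\<lambda>T. T \<union> case_prod j ` (T \<times> T)) ^^ n) S" for n
  have T0: "T 0 = S" and TSuc: "T (Suc n) = T n \<union> case_prod j ` (T n \<times> T n)" for n
    by (simp_all add: T_def)
  have "countable (T n)" for n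
    by (induction n) (auto simp: T0 TSuc assms)
  moreover have "mono T" unfolding mono_iff_le_Suc by (auto simp: TSuc)
  have "s \<in> (\<Union>n. T n)" if "s \<in> join_closure j S" for s
    using that
  proof induction
    case (base s)
    then show ?case using T0 by blast
  next
    case (join s t)
    then obtain m n where mn: "s \<in> T m" "t \<in> T n" by blast
    have "T m \<subseteq> T (max m n)" "T n \<subseteq> T (max m n)" by (intro monoD[OF \<open>mono T\<close>]; simp)+
    with mn have "(s, t) \<in> T (max m n) \<times> T (max m n)" by blast
    then have "j s t \<in> T (Suc (max m n))" unfolding TSuc by force
    then show ?case by blast
  qed
  then have "join_closure j S \<subseteq> (\<Union>n. T n)" by blast
  ultimately show ?thesis by (meson countable_UN countableI_type countable_subset)
qed

lemma join_closure_UN_incseq: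
  assumes "\<And>n. S n \<subseteq> S (Suc n)"
  shows "join_closure j (\<Union>n::nat. S n) = (\<Union>n. join_closure j (S n))"
proof
  have "mono S" using assms by (simp add: mono_iff_le_Suc)
  show "join_closure j (\<Union>n. S n) \<subseteq> (\<Union>n. join_closure j (S n))"
  proof
    fix s assume "s \<in> join_closure j (\<Union>n. S n)"
    then show "s \<in> (\<Union>n. join_closure j (S n))"
    proof induction
      case (base s)
      then show ?case by (auto intro: join_closure.base)
    next
      case (join s t)
      then obtain m n where "s \<in> join_closure j (S m)" "t \<in> join_closure j (S n)" by blast
      moreover have "S m \<subseteq> S (max m n)" "S n \<subseteq> S (max m n)"
        by (intro monoD[OF \<open>mono S\<close>]; simp)+
      ultimately have "s \<in> join_closure j (S (max m n))" "t \<in> join_closure j (S (max m n))"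
        using join_closure_mono by blast+
      then show ?case by (blast intro: join_closure.join)
    qed
  qed
  show "(\<Union>n. join_closure j (S n)) \<subseteq> join_closure j (\<Union>n. S n)"
    by (intro UN_least join_closure_mono) blast
qed

section \<open>Projections and separable subspaces\<close>

lemma range_bounded_projection:
  assumes "bounded_projection P"
  shows "range (blinfun_apply P) = {x. blinfun_apply P x = x}"
proof -
  have "blinfun_apply P (blinfun_apply P x) = blinfun_apply P x" for x
    using assms unfolding bounded_projection_def by (metis blinfun_apply_blinfun_compose)
  then show ?thesis by (auto intro: rangeI) (metis rangeI)
qed

lemma closed_range_bounded_projection:
  assumes "bounded_projection P"
  shows "closed (range (blinfun_apply P))"
  unfolding range_bounded_projection[OF assms]
  by (intro closed_Collect_eq continuous_intros)

lemma subspace_range_blinfun: "subspace (range (blinfun_apply T))"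
  by (simp add: linear_subspace_image blinfun.bounded_linear_right bounded_linear.linear)

lemma range_subset_of_compose_eq:
  assumes "P = Q o\<^sub>L P"
  shows "range (blinfun_apply P) \<subseteq> range (blinfun_apply Q)"
  using assms by (metis blinfun_apply_blinfun_compose image_subsetI rangeI)

text \<open>
  A projection is the identity on its range, so \<open>P\<close> fixes every \<open>Q x\<close>. Applied to comparable
  members of a skeleton, this says that equal ranges force equal projections.
\<close>

lemma compatible_projections_eqI:
  assumes "bounded_projection P" "P = P o\<^sub>L Q"
    and "range (blinfun_apply Q) \<subseteq> range (blinfun_apply P)"
  shows "P = Q"
proof (rule blinfun_eqI)
  fix x
  have "blinfun_apply P (blinfun_apply Q x) = blinfun_apply Q x"
    using assms(1,3) range_bounded_projection by blast
  then show "blinfun_apply P x = blinfun_apply Q x"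
    using assms(2) by (metis blinfun_apply_blinfun_compose)
qed

lemma closure_UN_closure: "closure (\<Union>i. closure (S i)) = closure (\<Union>i. S i)"
proof (rule antisym)
  show "closure (\<Union>i. closure (S i)) \<subseteq> closure (\<Union>i. S i)"
    by (intro closure_minimal UN_least closure_mono) auto
  show "closure (\<Union>i. S i) \<subseteq> closure (\<Union>i. closure (S i))"
    using closure_subset by (intro closure_mono) blast
qed

lemma closure_subspace:
  fixes S :: "'a::real_normed_vector set"
  assumes "subspace S"
  shows "subspace (closure S)"
proof (rule subspaceI)
  show "0 \<in> closure S" using assms subspace_0 closure_subset by blast
  fix x y c assume "x \<in> closure S"
  then obtain f where f: "\<And>n. f n \<in> S" "f \<longlonglongrightarrow> x"
    unfolding closure_sequential by blast
  then show "c *\<^sub>R x \<in> closure S"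
    unfolding closure_sequential
    using assms by (intro exI[of _ "\<lambda>n. c *\<^sub>R f n"]) (auto intro: tendsto_intros subspace_scale)
  assume "y \<in> closure S"
  then obtain g where "\<And>n. g n \<in> S" "g \<longlonglongrightarrow> y"
    unfolding closure_sequential by blast
  with f show "x + y \<in> closure S"
    unfolding closure_sequential
    using assms by (intro exI[of _ "\<lambda>n. f n + g n"]) (auto intro: tendsto_intros subspace_add)
qed

lemma subspace_closure_UN_incseq:
  fixes E :: "nat \<Rightarrow> 'a::real_normed_vector set"
  assumes "\<And>n. subspace (E n)" "\<And>n. E n \<subseteq> E (Suc n)"
  shows "subspace (closure (\<Union>n. E n))"
proof (rule closure_subspace, rule subspaceI)
  have "mono E" using assms(2) by (simp add: mono_iff_le_Suc)
  show "0 \<in> (\<Union>n. E n)" using assms(1) subspace_0 by blast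
  show "x + y \<in> (\<Union>n. E n)" if xy: "x \<in> (\<Union>n. E n)" "y \<in> (\<Union>n. E n)" for x y
  proof -
    obtain m n where "x \<in> E m" "y \<in> E n" using xy by blast
    then have "x \<in> E (max m n)" "y \<in> E (max m n)"
      using monoD[OF \<open>mono E\<close>, of m "max m n"] monoD[OF \<open>mono E\<close>, of n "max m n"] by auto
    then have "x + y \<in> E (max m n)" using assms(1) subspace_add by blast
    then show ?thesis by blast
  qed
  show "a *\<^sub>R x \<in> (\<Union>n. E n)" if "x \<in> (\<Union>n. E n)" for a x
    using that assms(1) subspace_scale by blast
qed

lemma separable_set_closure_UN:
  fixes E :: "nat \<Rightarrow> 'a::topological_space set"
  assumes "\<And>n. separable_set (E n)"
  shows "separable_set (closure (\<Union>n. E n))"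
proof -
  have "\<forall>n. \<exists>C. countable C \<and> C \<subseteq> E n \<and> E n \<subseteq> closure C"
    using assms unfolding separable_set_iff by blast
  then obtain C where C: "\<And>n. countable (C n)" "\<And>n. C n \<subseteq> E n" "\<And>n. E n \<subseteq> closure (C n)"
    by metis
  show ?thesis
  proof (rule separable_setI)
    show "countable (\<Union>n. C n)" using C(1) by simp
    have "(\<Union>n. C n) \<subseteq> (\<Union>n. E n)" using C(2) by (rule UN_mono[OF order_refl])
    then show "(\<Union>n. C n) \<subseteq> closure (\<Union>n. E n)" using closure_subset by (rule order_trans)
    have "E n \<subseteq> closure (\<Union>n. C n)" for n
      using C(3)[of n] closure_mono[of "C n" "\<Union>n. C n"] by blast
    then show "closure (\<Union>n. E n) \<subseteq> closure (\<Union>n. C n)"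
      by (intro closure_minimal) auto
  qed
qed

lemma separable_set_span_Un:
  fixes E F :: "'a::real_normed_vector set"
  assumes "subspace E" "subspace F" "separable_set E" "separable_set F"
  shows "separable_set (span (E \<union> F))"
proof -
  obtain B where B: "countable B" "B \<subseteq> E" "E \<subseteq> closure B" using assms(3) by (rule separable_setE)
  obtain C where C: "countable C" "C \<subseteq> F" "F \<subseteq> closure C" using assms(4) by (rule separable_setE)
  have span: "span (E \<union> F) = {x + y |x y. x \<in> E \<and> y \<in> F}"
    using assms(1,2) by (simp only: span_Un span_eq_iff[THEN iffD2])
  show ?thesis
  proof (rule separable_setI)
    show "countable (case_prod (+) ` (B \<times> C))" using B(1) C(1) by blast
    show "case_prod (+) ` (B \<times> C) \<subseteq> span (E \<union> F)" unfolding span using B(2) C(2) by auto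
    have "case_prod (+) ` closure (B \<times> C) \<subseteq> closure (case_prod (+) ` (B \<times> C))"
      by (rule image_closure_subset) (auto intro!: continuous_intros simp: split_beta closure_subset)
    then show "span (E \<union> F) \<subseteq> closure (case_prod (+) ` (B \<times> C))"
      unfolding span closure_Times using B(3) C(3) by fast
  qed
qed

section \<open>Countable directed sets in a skeleton\<close>

lemma projectional_skeletonD:
  assumes "projectional_skeleton I R P"
  shows "s \<in> I \<Longrightarrow> (s, s) \<in> R"
    and "(s, t) \<in> R \<Longrightarrow> (t, u) \<in> R \<Longrightarrow> (s, u) \<in> R"
    and "s \<in> I \<Longrightarrow> t \<in> I \<Longrightarrow> \<exists>u\<in>I. (s, u) \<in> R \<and> (t, u) \<in> R"
    and "s \<in> I \<Longrightarrow> bounded_projection (P s)"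
    and "s \<in> I \<Longrightarrow> separable_set (range (blinfun_apply (P s)))"
    and "\<exists>s\<in>I. x \<in> range (blinfun_apply (P s))"
    and "(s, t) \<in> R \<Longrightarrow> s \<in> I \<Longrightarrow> t \<in> I \<Longrightarrow> P s = P s o\<^sub>L P t"
    and "(s, t) \<in> R \<Longrightarrow> s \<in> I \<Longrightarrow> t \<in> I \<Longrightarrow> P s = P t o\<^sub>L P s"
    and "(s, t) \<in> R \<Longrightarrow> s \<in> I \<Longrightarrow> t \<in> I \<Longrightarrow>
      range (blinfun_apply (P s)) \<subseteq> range (blinfun_apply (P t))"
    and "(\<And>n. \<sigma> n \<in> I) \<Longrightarrow> (\<And>n. (\<sigma> n, \<sigma> (Suc n)) \<in> R) \<Longrightarrow> (\<And>n. \<sigma> n \<noteq> \<sigma> (Suc n)) \<Longrightarrow>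
      \<exists>t. is_supremum_on I R (range \<sigma>) t \<and>
        range (blinfun_apply (P t)) = closure (\<Union>n. range (blinfun_apply (P (\<sigma> n))))"
proof -
  show "(s, t) \<in> R \<Longrightarrow> s \<in> I \<Longrightarrow> t \<in> I \<Longrightarrow> P s = P s o\<^sub>L P t"
    and le: "(s, t) \<in> R \<Longrightarrow> s \<in> I \<Longrightarrow> t \<in> I \<Longrightarrow> P s = P t o\<^sub>L P s" for s t
    using assms unfolding projectional_skeleton_def by blast+
  from range_subset_of_compose_eq[OF le]
  show "(s, t) \<in> R \<Longrightarrow> s \<in> I \<Longrightarrow> t \<in> I \<Longrightarrow>
      range (blinfun_apply (P s)) \<subseteq> range (blinfun_apply (P t))" .
  show "s \<in> I \<Longrightarrow> (s, s) \<in> R" "(s, t) \<in> R \<Longrightarrow> (t, u) \<in> R \<Longrightarrow> (s, u) \<in> R"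
    using assms unfolding projectional_skeleton_def partial_order_on_def preorder_on_def
    by (auto dest: refl_onD transD)
  show "s \<in> I \<Longrightarrow> t \<in> I \<Longrightarrow> \<exists>u\<in>I. (s, u) \<in> R \<and> (t, u) \<in> R"
    using assms unfolding projectional_skeleton_def up_directed_on_def by blast
  show "\<exists>s\<in>I. x \<in> range (blinfun_apply (P s))"
    using assms unfolding projectional_skeleton_def by blast
qed (use assms in \<open>simp_all add: projectional_skeleton_def\<close>)

text \<open>
  The skeleton axiom concerns strictly increasing sequences. A countable directed set with a
  greatest element has that element as its supremum; in any other, an enumeration yields a cofinal
  sequence in which every step can be made strict, because no element is an upper bound of the rest.
\<close>

lemma countable_directed_supremum:
  assumes sk: "projectional_skeleton I R P"
    and S: "S \<subseteq> I" "S \<noteq> {}" "countable S" "up_directed_on S R"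
  obtains t where "is_supremum_on I R S t"
    "range (blinfun_apply (P t)) = closure (\<Union>s\<in>S. range (blinfun_apply (P s)))"
proof (cases "\<exists>t\<in>S. \<forall>s\<in>S. (s, t) \<in> R")
  case True
  then obtain t where t: "t \<in> S" "\<And>s. s \<in> S \<Longrightarrow> (s, t) \<in> R" by blast
  then have "(\<Union>s\<in>S. range (blinfun_apply (P s))) = range (blinfun_apply (P t))"
    using projectional_skeletonD(9)[OF sk] S(1) by blast
  moreover have "closed (range (blinfun_apply (P t)))"
    using t(1) S(1) projectional_skeletonD(4)[OF sk] closed_range_bounded_projection by blast
  moreover have "is_supremum_on I R S t"
    using t S(1) unfolding is_supremum_on_def by blast
  ultimately show thesis using that by simp
next
  case False
  define e where "e = from_nat_into S"
  have e: "range e = S" unfolding e_def using S(2,3) by (simp add: range_from_nat_into)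
  have step: "\<exists>u\<in>S. (s, u) \<in> R \<and> s \<noteq> u \<and> (e n, u) \<in> R" if "s \<in> S" for s n
  proof -
    obtain v where v: "v \<in> S" "(v, s) \<notin> R" using False \<open>s \<in> S\<close> by blast
    obtain w where w: "w \<in> S" "(s, w) \<in> R" "(v, w) \<in> R"
      using S(4) \<open>s \<in> S\<close> v(1) unfolding up_directed_on_def by blast
    have "e n \<in> S" using e by blast
    with w(1) obtain u where u: "u \<in> S" "(w, u) \<in> R" "(e n, u) \<in> R"
      using S(4) unfolding up_directed_on_def by blast
    have "(s, u) \<in> R" "(v, u) \<in> R"
      using w u projectional_skeletonD(2)[OF sk] by blast+
    with u v(2) show ?thesis by blast
  qed
  have "\<exists>\<sigma>. \<forall>n. \<sigma> n \<in> S \<and>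
    (\<sigma> n, \<sigma> (Suc n)) \<in> R \<and> \<sigma> n \<noteq> \<sigma> (Suc n) \<and> (e n, \<sigma> (Suc n)) \<in> R"
    by (rule dependent_nat_choice) (use step S(2) in auto)
  then obtain \<sigma> where \<sigma>: "\<And>n. \<sigma> n \<in> S"
    "\<And>n. (\<sigma> n, \<sigma> (Suc n)) \<in> R" "\<And>n. \<sigma> n \<noteq> \<sigma> (Suc n)" "\<And>n. (e n, \<sigma> (Suc n)) \<in> R" by metis
  have "\<sigma> n \<in> I" for n using \<sigma>(1) S(1) by blast
  then obtain t where t: "is_supremum_on I R (range \<sigma>) t"
    "range (blinfun_apply (P t)) = closure (\<Union>n. range (blinfun_apply (P (\<sigma> n))))"
    using projectional_skeletonD(10)[OF sk, of \<sigma>] \<sigma>(2,3) by metis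
  have cof: "\<exists>n. (s, \<sigma> n) \<in> R" if "s \<in> S" for s
    using that e \<sigma>(4) by (metis imageE)
  show thesis
  proof (rule that)
    show "is_supremum_on I R S t"
      unfolding is_supremum_on_def
    proof (intro conjI ballI impI)
      show "t \<in> I" using t(1) unfolding is_supremum_on_def by blast
    next
      fix s assume "s \<in> S"
      then obtain n where "(s, \<sigma> n) \<in> R" using cof by blast
      moreover have "(\<sigma> n, t) \<in> R" using t(1) unfolding is_supremum_on_def by blast
      ultimately show "(s, t) \<in> R" using projectional_skeletonD(2)[OF sk] by blast
    next
      fix u assume "u \<in> I" "\<forall>s\<in>S. (s, u) \<in> R"
      then show "(t, u) \<in> R" using t(1) \<sigma>(1) unfolding is_supremum_on_def by auto
    qed
    have "(\<Union>s\<in>S. range (blinfun_apply (P s))) = (\<Union>n. range (blinfun_apply (P (\<sigma> n))))"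
    proof
      show "(\<Union>s\<in>S. range (blinfun_apply (P s))) \<subseteq> (\<Union>n. range (blinfun_apply (P (\<sigma> n))))"
      proof (rule UN_least)
        fix s assume "s \<in> S"
        moreover obtain n where "(s, \<sigma> n) \<in> R" using cof \<open>s \<in> S\<close> by blast
        ultimately have "range (blinfun_apply (P s)) \<subseteq> range (blinfun_apply (P (\<sigma> n)))"
          using projectional_skeletonD(9)[OF sk] S(1) \<sigma>(1) by blast
        then show "range (blinfun_apply (P s)) \<subseteq> (\<Union>n. range (blinfun_apply (P (\<sigma> n))))" by blast
      qed
    qed (use \<sigma>(1) in blast)
    with t(2) show "range (blinfun_apply (P t)) =
        closure (\<Union>s\<in>S. range (blinfun_apply (P s)))" by simp
  qed
qed

section \<open>From a skeleton to a simple skeleton\<close>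

text \<open>
  The simple skeleton is a reindexing of the given one: \<open>E\<close> receives the projection with index
  \<open>\<tau> E\<close>. In this form every property that concerns single projections or arbitrary pairs of
  projections is inherited.
\<close>

lemma simple_skeleton_of_skeleton:
  fixes P :: "'i \<Rightarrow> ('a::real_normed_vector \<Rightarrow>\<^sub>L 'a)"
  assumes sk: "projectional_skeleton I R P"
  obtains \<F> \<tau> where "\<tau> ` \<F> \<subseteq> I" "simple_projectional_skeleton \<F> (P \<circ> \<tau>)"
    "induced_subspace \<F> (P \<circ> \<tau>) = induced_subspace I P"
proof -
  note skD = projectional_skeletonD[OF sk]
  let ?ran = "\<lambda>s. range (blinfun_apply (P s))"
  obtain A :: "'a set \<Rightarrow> 'a set" where A:
    "\<And>E F. E \<subseteq> F \<Longrightarrow> A E \<subseteq> A F" "\<And>E. separable_set E \<Longrightarrow> countable (A E)"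
    "\<And>E. E \<subseteq> closure (A E)" "\<And>\<E>. A (closure (\<Union>\<E>)) = (\<Union>E\<in>\<E>. A E)"
    using countable_trace by blast
  obtain c where c: "\<And>x. c x \<in> I" "\<And>x. x \<in> ?ran (c x)"
    using skD(6) by metis
  obtain j where j: "\<And>s t. s \<in> I \<Longrightarrow> t \<in> I \<Longrightarrow> j s t \<in> I"
    "\<And>s t. s \<in> I \<Longrightarrow> t \<in> I \<Longrightarrow> (s, j s t) \<in> R" "\<And>s t. s \<in> I \<Longrightarrow> t \<in> I \<Longrightarrow> (t, j s t) \<in> R"
    using skD(3) by metis
  define G where "G E = join_closure j (c ` A E)" for E
  have G_I: "G E \<subseteq> I" for E
  proof
    fix s assume "s \<in> G E"
    then show "s \<in> I" unfolding G_def by induction (use c(1) j(1) in auto)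
  qed
  have G_dir: "up_directed_on (G E) R" for E
    unfolding up_directed_on_def
  proof (intro ballI)
    fix s t assume st: "s \<in> G E" "t \<in> G E"
    then have "j s t \<in> G E" unfolding G_def by (rule join_closure.join)
    moreover have "s \<in> I" "t \<in> I" using st G_I by blast+
    ultimately show "\<exists>u\<in>G E. (s, u) \<in> R \<and> (t, u) \<in> R" using j(2,3) by blast
  qed
  have G_mono: "G E \<subseteq> G F" if "E \<subseteq> F" for E F
    unfolding G_def using A(1)[OF that] by (intro join_closure_mono) blast
  have G_Un: "G (closure (\<Union>n. E n)) = (\<Union>n. G (E n))" if "\<And>n. E n \<subseteq> E (Suc n)" for E :: "nat \<Rightarrow> _"
  proof -
    have "c ` A (closure (\<Union>n. E n)) = (\<Union>n. c ` A (E n))"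
      using A(4)[of "range E"] by auto
    moreover have "c ` A (E n) \<subseteq> c ` A (E (Suc n))" for n
      using A(1)[OF that] by blast
    ultimately show ?thesis unfolding G_def by (simp add: join_closure_UN_incseq)
  qed
  have ex: "\<exists>t. is_supremum_on I R (G E) t \<and> ?ran t = closure (\<Union>s\<in>G E. ?ran s)"
    if "separable_set E" "E \<noteq> {}" for E
  proof -
    have "A E \<noteq> {}" using A(3)[of E] that(2) by auto
    then obtain x where "x \<in> A E" by blast
    then have "c x \<in> G E" unfolding G_def by (intro join_closure.base) simp
    then have "G E \<noteq> {}" by blast
    moreover have "countable (G E)"
      unfolding G_def using A(2)[OF that(1)] by (intro countable_join_closure) simp
    ultimately show ?thesis
      using countable_directed_supremum[OF sk G_I _ _ G_dir] by metis
  qed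
  define \<tau> where "\<tau> E = (SOME t. is_supremum_on I R (G E) t \<and> ?ran t = closure (\<Union>s\<in>G E. ?ran s))" for E
  have \<tau>: "is_supremum_on I R (G E) (\<tau> E)" "?ran (\<tau> E) = closure (\<Union>s\<in>G E. ?ran s)"
    if "subspace E" "separable_set E" for E
  proof -
    have "E \<noteq> {}" using that(1) subspace_0 by blast
    from someI_ex[OF ex[OF that(2) this]]
    show "is_supremum_on I R (G E) (\<tau> E)" "?ran (\<tau> E) = closure (\<Union>s\<in>G E. ?ran s)"
      unfolding \<tau>_def by blast+
  qed
  have \<tau>_I: "\<tau> E \<in> I" if "subspace E" "separable_set E" for E
    using \<tau>(1)[OF that] unfolding is_supremum_on_def by blast
  have \<tau>_mono: "(\<tau> E, \<tau> F) \<in> R"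
    if "subspace E" "separable_set E" "subspace F" "separable_set F" "E \<subseteq> F" for E F
    using \<tau>(1)[OF that(1,2)] \<tau>(1)[OF that(3,4)] G_mono[OF that(5)]
    unfolding is_supremum_on_def by blast
  have \<tau>_ext: "E \<subseteq> ?ran (\<tau> E)" if "subspace E" "separable_set E" for E
  proof -
    have "c x \<in> G E" if "x \<in> A E" for x
      unfolding G_def using that by (intro join_closure.base) simp
    then have "A E \<subseteq> (\<Union>s\<in>G E. ?ran s)" using c(2) by blast
    then have "closure (A E) \<subseteq> ?ran (\<tau> E)" using \<tau>(2)[OF that] closure_mono by simp
    with A(3) show ?thesis by blast
  qed
  have \<tau>_lim: "?ran (\<tau> (closure (\<Union>n. E n))) = closure (\<Union>n. ?ran (\<tau> (E n)))"
    if E: "\<And>n. subspace (E n)" "\<And>n. separable_set (E n)" "\<And>n. E n \<subseteq> E (Suc n)"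
    for E :: "nat \<Rightarrow> 'a set"
  proof -
    have "?ran (\<tau> (closure (\<Union>n. E n))) = closure (\<Union>s\<in>(\<Union>n. G (E n)). ?ran s)"
      using \<tau>(2)[OF subspace_closure_UN_incseq[of E, OF E(1,3)] separable_set_closure_UN[of E, OF E(2)]] G_Un[of E, OF E(3)] by simp
    also have "(\<Union>s\<in>(\<Union>n. G (E n)). ?ran s) = (\<Union>n. \<Union>s\<in>G (E n). ?ran s)" by blast
    also have "closure \<dots> = closure (\<Union>n. ?ran (\<tau> (E n)))"
      using closure_UN_closure[of "\<lambda>n. \<Union>s\<in>G (E n). ?ran s"] \<tau>(2)[OF E(1,2)] by simp
    finally show ?thesis .
  qed
  \<comment> \<open>since \<open>E \<subseteq> ?ran (\<tau> E)\<close> for separable subspaces, these are the fixed points of \<open>E \<mapsto> ?ran (\<tau> E)\<close>\<close>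
  define \<F> where "\<F> = {E. subspace E \<and> separable_set E \<and> ?ran (\<tau> E) = E}"
  have \<F>D: "subspace E" "separable_set E" "?ran (\<tau> E) = E" if "E \<in> \<F>" for E
    using that unfolding \<F>_def by auto
  have \<F>_lim: "closure (\<Union>n. E n) \<in> \<F>"
    if E: "\<And>n. E n \<in> \<F>" "\<And>n. E n \<subseteq> E (Suc n)" for E :: "nat \<Rightarrow> 'a set"
  proof -
    have "?ran (\<tau> (closure (\<Union>n. E n))) = closure (\<Union>n. E n)"
      using \<tau>_lim[of E, OF \<F>D(1,2)[OF E(1)] E(2)] \<F>D(3)[OF E(1)] by simp
    then show ?thesis
      unfolding \<F>_def
      using subspace_closure_UN_incseq[of E, OF \<F>D(1)[OF E(1)] E(2)]
        separable_set_closure_UN[of E, OF \<F>D(2)[OF E(1)]] by blast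
  qed
  have \<F>_cofinal: "\<exists>F\<in>\<F>. S \<subseteq> F" if S: "subspace S" "separable_set S" for S
  proof -
    \<comment> \<open>a fixed point above \<open>S\<close> is reached by iteration, by continuity along increasing unions\<close>
    define E where "E n = ((\<lambda>F. ?ran (\<tau> F)) ^^ n) S" for n
    have E0: "E 0 = S" and ESuc: "E (Suc n) = ?ran (\<tau> (E n))" for n
      by (simp_all add: E_def)
    have E: "subspace (E n) \<and> separable_set (E n)" for n
      by (induction n) (use S skD(5) \<tau>_I subspace_range_blinfun in \<open>simp_all add: E0 ESuc\<close>)
    have inc: "E n \<subseteq> E (Suc n)" for n using \<tau>_ext E ESuc by simp
    have "(\<Union>n. E (Suc n)) = (\<Union>n. E n)" using inc by blast
    then have "?ran (\<tau> (closure (\<Union>n. E n))) = closure (\<Union>n. E n)"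
      using \<tau>_lim[of E] E inc by (simp flip: ESuc)
    then have "closure (\<Union>n. E n) \<in> \<F>"
      using subspace_closure_UN_incseq[of E] separable_set_closure_UN[of E] E inc unfolding \<F>_def by simp
    moreover have "S \<subseteq> closure (\<Union>n. E n)"
      using E0 closure_subset[of "\<Union>n. E n"] by blast
    ultimately show ?thesis by blast
  qed
  have simple: "simple_projectional_skeleton \<F> (P \<circ> \<tau>)"
    unfolding simple_projectional_skeleton_def rich_family_def comp_def
  proof (intro conjI ballI allI impI)
    fix E F assume EF: "E \<in> \<F>" "F \<in> \<F>" "E \<subseteq> F"
    then have "(\<tau> E, \<tau> F) \<in> R" "\<tau> E \<in> I" "\<tau> F \<in> I"
      using \<F>D \<tau>_I \<tau>_mono by simp_all
    then show "P (\<tau> E) = P (\<tau> E) o\<^sub>L P (\<tau> F)" "P (\<tau> E) = P (\<tau> F) o\<^sub>L P (\<tau> E)"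
      by (rule skD(7), rule skD(8))
  qed (use \<F>D \<F>_lim \<F>_cofinal \<tau>_I skD(4) in \<open>auto\<close>)
  \<comment> \<open>The indices \<open>\<tau> E\<close> need not be cofinal in \<open>I\<close>, so \<open>\<tau> E\<close> cannot be expected above \<open>s\<close>;
    instead its projection is made equal to one whose index is above \<open>s\<close>.\<close>
  have absorb: "\<exists>E\<in>\<F>. P s = P s o\<^sub>L P (\<tau> E)" if s: "s \<in> I" for s
  proof -
    have "\<exists>F. F \<in> \<F> \<and> ?ran t \<subseteq> F" if "t \<in> I" for t
      using \<F>_cofinal[OF subspace_range_blinfun skD(5)[OF that]] by blast
    then obtain h where h: "\<And>t. t \<in> I \<Longrightarrow> h t \<in> \<F>" "\<And>t. t \<in> I \<Longrightarrow> ?ran t \<subseteq> h t"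
      by metis
    \<comment> \<open>the ranges of \<open>P (\<sigma> n)\<close> and the sets \<open>h (\<sigma> n)\<close> of \<open>\<F>\<close> interleave\<close>
    define \<sigma> where "\<sigma> n = ((\<lambda>t. j t (\<tau> (h t))) ^^ n) s" for n
    have \<sigma>0: "\<sigma> 0 = s" and \<sigma>Suc: "\<sigma> (Suc n) = j (\<sigma> n) (\<tau> (h (\<sigma> n)))" for n
      by (simp_all add: \<sigma>_def)
    have \<tau>h: "\<tau> (h t) \<in> I" if "t \<in> I" for t using h(1) \<F>D \<tau>_I that by blast
    have \<sigma>_I: "\<sigma> n \<in> I" for n
      by (induction n) (simp_all add: \<sigma>0 \<sigma>Suc s j(1) \<tau>h)
    define E where "E n = h (\<sigma> n)" for n
    have E_\<F>: "E n \<in> \<F>" for n using h(1) \<sigma>_I E_def by simp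
    have \<sigma>_le: "(\<sigma> n, \<sigma> (Suc n)) \<in> R" and \<tau>_le: "(\<tau> (E n), \<sigma> (Suc n)) \<in> R" for n
      unfolding \<sigma>Suc E_def using j(2,3) \<sigma>_I \<tau>h by blast+
    have ran_E: "?ran (\<sigma> n) \<subseteq> E n" for n using h(2) \<sigma>_I E_def by simp
    have E_ran: "E n \<subseteq> ?ran (\<sigma> (Suc n))" for n
      using skD(9)[OF \<tau>_le _ \<sigma>_I] \<F>D(3)[OF E_\<F>] \<tau>h[OF \<sigma>_I] unfolding E_def by metis
    have E_inc: "E n \<subseteq> E (Suc n)" for n using E_ran ran_E by blast
    have \<sigma>_mono: "(\<sigma> m, \<sigma> n) \<in> R" if "m \<le> n" for m n
      using that by (induction rule: dec_induct) (use skD(1,2) \<sigma>_I \<sigma>_le in blast)+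
    have "up_directed_on (range \<sigma>) R"
      unfolding up_directed_on_def
      using \<sigma>_mono by (metis imageE max.cobounded1 max.cobounded2 rangeI)
    then obtain u where u: "is_supremum_on I R (range \<sigma>) u"
      "?ran u = closure (\<Union>s\<in>range \<sigma>. ?ran s)"
      using countable_directed_supremum[OF sk, of "range \<sigma>"] \<sigma>_I by auto
    have u_I: "u \<in> I" and \<sigma>u: "(\<sigma> n, u) \<in> R" for n
      using u(1) unfolding is_supremum_on_def by blast+
    define F where "F = closure (\<Union>n. E n)"
    have F: "F \<in> \<F>" unfolding F_def using \<F>_lim E_\<F> E_inc by blast
    have "(\<Union>n. ?ran (\<sigma> n)) = (\<Union>n. E n)"
    proof
      show "(\<Union>n. ?ran (\<sigma> n)) \<subseteq> (\<Union>n. E n)" using ran_E by (intro UN_mono) simp_all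
      show "(\<Union>n. E n) \<subseteq> (\<Union>n. ?ran (\<sigma> n))" using E_ran by (intro UN_least) blast
    qed
    with u(2) have ran_u: "?ran u = F" unfolding F_def by simp
    \<comment> \<open>\<open>\<tau> F\<close> is a least upper bound of indices each of which lies below some \<open>\<tau> (E n)\<close>\<close>
    have "(t, u) \<in> R" if tF: "t \<in> G F" for t
    proof -
      obtain n where "t \<in> G (E n)" using tF unfolding F_def G_Un[of E, OF E_inc] by blast
      then have "(t, \<tau> (E n)) \<in> R"
        using \<tau>(1)[OF \<F>D(1,2)[OF E_\<F>]] unfolding is_supremum_on_def by blast
      then show ?thesis using \<tau>_le \<sigma>u skD(2) by blast
    qed
    then have "(\<tau> F, u) \<in> R"
      using \<tau>(1)[OF \<F>D(1,2)[OF F]] u_I unfolding is_supremum_on_def by blast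
    have \<tau>F: "\<tau> F \<in> I" using \<tau>_I[OF \<F>D(1,2)[OF F]] .
    have "P (\<tau> F) = P u"
    proof (rule compatible_projections_eqI)
      show "bounded_projection (P (\<tau> F))" using skD(4)[OF \<tau>F] .
      show "P (\<tau> F) = P (\<tau> F) o\<^sub>L P u" using skD(7)[OF \<open>(\<tau> F, u) \<in> R\<close> \<tau>F u_I] .
      show "?ran u \<subseteq> ?ran (\<tau> F)" unfolding ran_u \<F>D(3)[OF F] ..
    qed
    moreover have "P s = P s o\<^sub>L P u"
      using skD(7)[OF _ s u_I] \<sigma>u[of 0] unfolding \<sigma>0 by blast
    ultimately have "P s = P s o\<^sub>L P (\<tau> F)" by simp
    then show ?thesis using F by (rule bexI)
  qed
  have \<tau>_img: "\<tau> ` \<F> \<subseteq> I" by (intro image_subsetI \<tau>_I \<F>D(1,2))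
  have "induced_subspace \<F> (P \<circ> \<tau>) = induced_subspace I P"
  proof
    show "induced_subspace \<F> (P \<circ> \<tau>) \<subseteq> induced_subspace I P"
      unfolding induced_subspace_def comp_def using \<tau>_img by blast
    show "induced_subspace I P \<subseteq> induced_subspace \<F> (P \<circ> \<tau>)"
    proof
      fix f assume "f \<in> induced_subspace I P"
      then obtain s g where s: "s \<in> I" and f: "f = g o\<^sub>L P s"
        unfolding induced_subspace_def adjoint_blinfun_def by blast
      obtain E where E: "E \<in> \<F>" "P s = P s o\<^sub>L P (\<tau> E)" using absorb[OF s] by blast
      \<comment> \<open>\<open>f\<close> is its own preimage under the adjoint of \<open>P (\<tau> E)\<close>\<close>
      have "f = adjoint_blinfun (P (\<tau> E)) f"
      proof (rule blinfun_eqI)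
        fix x
        have "blinfun_apply (P s) x = blinfun_apply (P s) (blinfun_apply (P (\<tau> E)) x)"
          using E(2) by (metis blinfun_apply_blinfun_compose)
        then show "blinfun_apply f x = blinfun_apply (adjoint_blinfun (P (\<tau> E)) f) x"
          by (simp add: adjoint_blinfun_def f)
      qed
      then show "f \<in> induced_subspace \<F> (P \<circ> \<tau>)"
        unfolding induced_subspace_def using E(1) by auto
    qed
  qed
  then show thesis by (rule that[OF \<tau>_img simple])
qed

section \<open>From a simple skeleton to a skeleton\<close>

lemma skeleton_of_simple_skeleton:
  assumes "simple_projectional_skeleton \<F> P"
  shows "projectional_skeleton \<F> {(E, F). E \<in> \<F> \<and> F \<in> \<F> \<and> E \<subseteq> F} P"
    (is "projectional_skeleton _ ?R _")
proof -
  have rich: "rich_family \<F>" and proj: "\<And>F. F \<in> \<F> \<Longrightarrow> bounded_projection (P F)"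
    and ran: "\<And>F. F \<in> \<F> \<Longrightarrow> range (blinfun_apply (P F)) = F"
    and comp: "\<forall>E\<in>\<F>. \<forall>F\<in>\<F>. E \<subseteq> F \<longrightarrow> P E = P E o\<^sub>L P F \<and> P E = P F o\<^sub>L P E"
    using assms unfolding simple_projectional_skeleton_def by blast+
  have sub: "\<And>F. F \<in> \<F> \<Longrightarrow> subspace F" and sep: "\<And>F. F \<in> \<F> \<Longrightarrow> separable_set F"
    and cof: "\<And>S. subspace S \<Longrightarrow> separable_set S \<Longrightarrow> \<exists>F\<in>\<F>. S \<subseteq> F"
    and lim: "\<And>E :: nat \<Rightarrow> _. (\<And>n. E n \<in> \<F>) \<Longrightarrow> (\<And>n. E n \<subseteq> E (Suc n)) \<Longrightarrow> closure (\<Union>n. E n) \<in> \<F>"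
    using rich unfolding rich_family_def by blast+
  have "partial_order_on \<F> ?R"
    by (auto simp: partial_order_on_def preorder_on_def refl_on_def trans_def antisym_def)
  moreover have "up_directed_on \<F> ?R"
    unfolding up_directed_on_def
  proof (intro ballI)
    fix E F assume EF: "E \<in> \<F>" "F \<in> \<F>"
    then obtain H where "H \<in> \<F>" "span (E \<union> F) \<subseteq> H"
      using cof[OF subspace_span separable_set_span_Un] sub sep by metis
    then show "\<exists>H\<in>\<F>. (E, H) \<in> ?R \<and> (F, H) \<in> ?R"
      using EF span_superset[of "E \<union> F"] by auto
  qed
  moreover have "(\<Union>F\<in>\<F>. range (blinfun_apply (P F))) = UNIV"
  proof -
    have "\<exists>F\<in>\<F>. x \<in> F" for x
    proof -
      have "separable_set (range (\<lambda>k::real. k *\<^sub>R x))"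
      proof (rule separable_setI)
        show "countable ((\<lambda>k. k *\<^sub>R x) ` \<rat>)" by (simp add: countable_rat)
        show "(\<lambda>k. k *\<^sub>R x) ` \<rat> \<subseteq> range (\<lambda>k. k *\<^sub>R x)" by blast
        have "(\<lambda>k. k *\<^sub>R x) ` closure \<rat> \<subseteq> closure ((\<lambda>k. k *\<^sub>R x) ` \<rat>)"
          by (rule image_closure_subset) (auto intro!: continuous_intros simp: closure_subset)
        then show "range (\<lambda>k. k *\<^sub>R x) \<subseteq> closure ((\<lambda>k. k *\<^sub>R x) ` \<rat>)"
          by (simp add: Rats_closure_real)
      qed
      then obtain F where "F \<in> \<F>" "span {x} \<subseteq> F"
        using cof[OF subspace_span[of "{x}"]] span_singleton[of x] by metis
      then show ?thesis using span_superset[of "{x}"] by blast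
    qed
    then show ?thesis using ran by blast
  qed
  moreover have "\<exists>t. is_supremum_on \<F> ?R (range \<sigma>) t \<and>
      range (blinfun_apply (P t)) = closure (\<Union>n. range (blinfun_apply (P (\<sigma> n))))"
    if \<sigma>: "\<forall>n. \<sigma> n \<in> \<F>" "\<forall>n. (\<sigma> n, \<sigma> (Suc n)) \<in> ?R \<and> \<sigma> n \<noteq> \<sigma> (Suc n)" for \<sigma> :: "nat \<Rightarrow> _"
  proof (intro exI conjI)
    let ?t = "closure (\<Union>n. \<sigma> n)"
    have t: "?t \<in> \<F>" using \<sigma> by (intro lim) auto
    have "?t \<subseteq> F" if "F \<in> \<F>" "\<And>n. \<sigma> n \<subseteq> F" for F
    proof (rule closure_minimal)
      show "closed F" using closed_range_bounded_projection[OF proj[OF that(1)]] ran[OF that(1)] by simp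
    qed (use that(2) in blast)
    moreover have "\<sigma> n \<subseteq> ?t" for n using closure_subset[of "\<Union>n. \<sigma> n"] by blast
    ultimately show "is_supremum_on \<F> ?R (range \<sigma>) ?t"
      using t \<sigma>(1) unfolding is_supremum_on_def by auto
    show "range (blinfun_apply (P ?t)) = closure (\<Union>n. range (blinfun_apply (P (\<sigma> n))))"
      using ran t \<sigma>(1) by simp
  qed
  ultimately show ?thesis
    unfolding projectional_skeleton_def using proj sep ran comp by simp
qed

lemma simple_skeleton_imp_skeleton:
  "has_simple_skeleton r (D :: ('a::real_normed_vector \<Rightarrow>\<^sub>L real) set) \<Longrightarrow>
     has_skeleton TYPE('a set) r D"
  "has_simple_commutative_skeleton r D \<Longrightarrow> has_commutative_skeleton TYPE('a set) r D"
  unfolding has_simple_skeleton_def has_skeleton_def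
    has_simple_commutative_skeleton_def has_commutative_skeleton_def
  using skeleton_of_simple_skeleton by blast+

lemma skeleton_imp_simple_skeleton:
  fixes D :: "('a::real_normed_vector \<Rightarrow>\<^sub>L real) set"
  shows "has_skeleton TYPE('i) r D \<Longrightarrow> has_simple_skeleton r D"
    and "has_commutative_skeleton TYPE('i) r D \<Longrightarrow> has_simple_commutative_skeleton r D"
proof -
  assume "has_skeleton TYPE('i) r D"
  then obtain I :: "'i set" and R P where
    sk: "projectional_skeleton I R P" "norms_bounded_by r I P" "D = induced_subspace I P"
    unfolding has_skeleton_def by blast
  obtain \<F> \<tau> where "\<tau> ` \<F> \<subseteq> I" "simple_projectional_skeleton \<F> (P \<circ> \<tau>)"
    "induced_subspace \<F> (P \<circ> \<tau>) = induced_subspace I P"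
    by (rule simple_skeleton_of_skeleton[OF sk(1)])
  moreover from this sk(2) have "norms_bounded_by r \<F> (P \<circ> \<tau>)"
    unfolding norms_bounded_by_def by auto
  ultimately show "has_simple_skeleton r D"
    unfolding has_simple_skeleton_def using sk(3) by blast
next
  assume "has_commutative_skeleton TYPE('i) r D"
  then obtain I :: "'i set" and R P where
    sk: "projectional_skeleton I R P" "norms_bounded_by r I P" "commutative_family I P"
      "D = induced_subspace I P"
    unfolding has_commutative_skeleton_def by blast
  obtain \<F> \<tau> where "\<tau> ` \<F> \<subseteq> I" "simple_projectional_skeleton \<F> (P \<circ> \<tau>)"
    "induced_subspace \<F> (P \<circ> \<tau>) = induced_subspace I P"
    by (rule simple_skeleton_of_skeleton[OF sk(1)])
  moreover from this sk(2,3) have "norms_bounded_by r \<F> (P \<circ> \<tau>)" "commutative_family \<F> (P \<circ> \<tau>)"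
    unfolding norms_bounded_by_def commutative_family_def by (auto simp: image_subset_iff)
  ultimately show "has_simple_commutative_skeleton r D"
    unfolding has_simple_commutative_skeleton_def using sk(4) by blast
qed

theorem theorem12:
  fixes r :: real and D :: "('a::banach \<Rightarrow>\<^sub>L real) set"
  assumes "r \<ge> 1" and "subspace D" and "norming r D"
  shows
    "((has_skeleton TYPE('i) r D \<longrightarrow> has_simple_skeleton r D) \<and>
      (has_skeleton TYPE('a set) r D \<longleftrightarrow> has_simple_skeleton r D)) \<and>
     ((has_commutative_skeleton TYPE('i) r D \<longrightarrow> has_simple_commutative_skeleton r D) \<and>
      (has_commutative_skeleton TYPE('a set) r D \<longleftrightarrow> has_simple_commutative_skeleton r D))"
  by (blast intro: skeleton_imp_simple_skeleton simple_skeleton_imp_skeleton)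

end
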